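(* For every graph $G$ and every non-universal vertex $v\in V(G)$ there exists an avoidable vertex $a$ of $G$ with $a\in V(G)\setminus N[v]$.
   Context: Graphs are finite, simple, undirected, with non-empty vertex set. $N[v]$ is the closed neighborhood of $v$, consisting of $v$ and all its neighbors. A vertex is universal if it is adjacent to every other vertex, and non-universal otherwise. A vertex $v$ of a graph $G$ is avoidable if for every two distinct neighbors $x,y$ of $v$ there is an $x,y$-path in $G$ none of whose internal vertices is $v$ or a neighbor of $v$; equivalently, every induced $P_3$ (three-vertex path) having $v$ as its midpoint is contained in an induced cycle of $G$. *)

theory Defs
  imports "Graph_Theory.Graph_Theory"
begin

text \<open>
  Finite simple undirected graphs are the locale \<^locale>\<open>graph\<close>: finite symmetric digraphs
  without loops and parallel arcs, where an undirected edge is a pair of opposite arcs. The null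
  graph is an instance, so non-emptiness of the vertex set has to be required separately.
\<close>

definition neighborhood :: "('a, 'b) pre_digraph \<Rightarrow> 'a \<Rightarrow> 'a set" where
  "neighborhood G v = {u \<in> verts G. v \<rightarrow>\<^bsub>G\<^esub> u}"

definition closed_neighborhood :: "('a, 'b) pre_digraph \<Rightarrow> 'a \<Rightarrow> 'a set" where
  "closed_neighborhood G v = insert v (neighborhood G v)"

definition universal_vertex :: "('a, 'b) pre_digraph \<Rightarrow> 'a \<Rightarrow> bool" where
  "universal_vertex G v \<longleftrightarrow> v \<in> verts G \<and> (\<forall>u \<in> verts G. u \<noteq> v \<longrightarrow> v \<rightarrow>\<^bsub>G\<^esub> u)"

text \<open>
  A path is given by its list of arcs, and the internal vertices are the tails of all arcs but
  the first; a path consisting of a single arc has none.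
\<close>
definition avoidable :: "('a, 'b) pre_digraph \<Rightarrow> 'a \<Rightarrow> bool" where
  "avoidable G v \<longleftrightarrow> v \<in> verts G \<and>
     (\<forall>x \<in> neighborhood G v. \<forall>y \<in> neighborhood G v. x \<noteq> y \<longrightarrow>
        (\<exists>p. pre_digraph.apath G x p y \<and>
             set (pre_digraph.inner_verts G p) \<inter> closed_neighborhood G v = {}))"

end

theory Submission
  imports Defs
begin

text \<open>
  Enlarge \<open>v\<close> to a connected set \<open>W\<close> that is maximal subject to the set \<open>F\<close> of vertices outside
  \<open>W\<close> and without a neighbour in \<open>W\<close> being non-empty. By maximality, every vertex of
  \<open>N(W)\<close> is adjacent to all of \<open>F\<close>. Induction inside \<open>F\<close> (or any vertex, if \<open>F\<close> is a clique) gives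
  a vertex \<open>a\<close> that is avoidable in \<open>F\<close>. It is avoidable in \<open>G\<close>: two of its neighbours in
  \<open>N(W)\<close> are joined through \<open>W\<close>, and one in \<open>N(W)\<close> is adjacent to any one in \<open>F\<close>.
\<close>

text \<open>The relation \<open>E\<close> stays fixed and the vertex set \<open>C\<close> is a
  parameter, so passing to an induced subgraph in the induction only means shrinking
  \<open>C\<close>.\<close>

definition non_neighbors :: "'a rel \<Rightarrow> 'a set \<Rightarrow> 'a set \<Rightarrow> 'a set" where
  "non_neighbors E C W = {u \<in> C - W. \<forall>w \<in> W. (w, u) \<notin> E}"

definition connected_on :: "'a rel \<Rightarrow> 'a set \<Rightarrow> bool" where
  "connected_on E W \<longleftrightarrow> (\<forall>x \<in> W. \<forall>y \<in> W. (x, y) \<in> rtrancl_on W E)"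

text \<open>Walks replace paths here. The endpoints are added to the allowed set because
  \<open>rtrancl_on\<close> keeps every vertex of the walk inside it; the case \<open>x = y\<close>
  is trivial by reflexivity.\<close>

definition avoidable_on :: "'a rel \<Rightarrow> 'a set \<Rightarrow> 'a \<Rightarrow> bool" where
  "avoidable_on E C a \<longleftrightarrow> (\<forall>x \<in> C. \<forall>y \<in> C. (a, x) \<in> E \<longrightarrow> (a, y) \<in> E \<longrightarrow>
     (x, y) \<in> rtrancl_on ({x, y} \<union> non_neighbors E C {a}) E)"

lemma rtrancl_on_edge:
  assumes "(x, y) \<in> E" "x \<in> A" "y \<in> A"
  shows "(x, y) \<in> rtrancl_on A E"
  using assms by (meson rtrancl_on_refl rtrancl_on_into_rtrancl_on)

lemma rtrancl_on_through_connected: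
  assumes "sym E" "connected_on E W" "W \<subseteq> A" "x \<in> A" "y \<in> A"
    and "w \<in> W" "(w, x) \<in> E" "w' \<in> W" "(w', y) \<in> E"
  shows "(x, y) \<in> rtrancl_on A E"
proof -
  have "(w, w') \<in> rtrancl_on A E"
    using assms by (intro rtrancl_on_mono[of E E W A]) (auto simp: connected_on_def)
  moreover have "(x, w) \<in> E"
    using assms by (meson symD)
  ultimately show ?thesis
    using assms by (meson converse_rtrancl_on_into_rtrancl_on rtrancl_on_into_rtrancl_on)
qed

lemma connected_on_insert:
  assumes "sym E" "connected_on E W" "w \<in> W" "(w, u) \<in> E"
  shows "connected_on E (insert u W)"
proof -
  have W: "(x, y) \<in> rtrancl_on (insert u W) E" if "x \<in> W" "y \<in> W" for x y
    using assms(2) that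
    by (intro rtrancl_on_mono[of E E W "insert u W"]) (auto simp: connected_on_def)
  have "(u, w) \<in> E"
    using assms by (meson symD)
  then have "(u, y) \<in> rtrancl_on (insert u W) E" "(y, u) \<in> rtrancl_on (insert u W) E"
    if "y \<in> W" for y
    using W[OF \<open>w \<in> W\<close> that] W[OF that \<open>w \<in> W\<close>] \<open>(w, u) \<in> E\<close>
    by (auto intro: converse_rtrancl_on_into_rtrancl_on rtrancl_on_into_rtrancl_on)
  with W show ?thesis
    unfolding connected_on_def by auto
qed

text \<open>If some \<open>u\<close> in N(W) missed some \<open>f\<close>, then
  \<open>insert u W\<close> would still be connected and \<open>f\<close> would still lie outside
  its closed neighbourhood, contradicting maximality.\<close>

lemma maximal_connected_on:
  assumes "finite C" "sym E" "v \<in> C" "non_neighbors E C {v} \<noteq> {}"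
  obtains W where "W \<subseteq> C" "v \<in> W" "connected_on E W" "non_neighbors E C W \<noteq> {}"
    "\<forall>u \<in> C - W. \<forall>w \<in> W. \<forall>f \<in> non_neighbors E C W. (w, u) \<in> E \<longrightarrow> (u, f) \<in> E"
proof -
  define \<W> where
    "\<W> = {W. W \<subseteq> C \<and> v \<in> W \<and> connected_on E W \<and> non_neighbors E C W \<noteq> {}}"
  have "finite \<W>"
    using \<open>finite C\<close> by (auto simp: \<W>_def intro: finite_subset[of _ "Pow C"])
  moreover have "{v} \<in> \<W>"
    using assms by (simp add: \<W>_def connected_on_def)
  ultimately obtain W where W: "W \<in> \<W>" and max: "\<And>W'. W' \<in> \<W> \<Longrightarrow> W \<subseteq> W' \<Longrightarrow> W = W'"
    using finite_has_maximal[of \<W>] by auto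
  have "\<forall>u \<in> C - W. \<forall>w \<in> W. \<forall>f \<in> non_neighbors E C W. (w, u) \<in> E \<longrightarrow> (u, f) \<in> E"
  proof (intro ballI impI)
    fix u w f
    assume u: "u \<in> C - W" "w \<in> W" "(w, u) \<in> E" and f: "f \<in> non_neighbors E C W"
    have "connected_on E (insert u W)"
      using W u \<open>sym E\<close> by (auto simp: \<W>_def intro: connected_on_insert)
    moreover have "insert u W \<notin> \<W>"
      using max u by blast
    ultimately have "non_neighbors E C (insert u W) = {}"
      using W u by (auto simp: \<W>_def)
    moreover have "f \<noteq> u"
      using u f by (auto simp: non_neighbors_def)
    ultimately show "(u, f) \<in> E"
      using f by (auto simp: non_neighbors_def)
  qed
  with W show ?thesis
    by (intro that[of W]) (simp_all add: \<W>_def)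
qed

lemma exists_avoidable_on:
  assumes "finite C" "sym E" "v \<in> C" "non_neighbors E C {v} \<noteq> {}"
  shows "\<exists>a \<in> non_neighbors E C {v}. avoidable_on E C a"
  using assms
proof (induction "card C" arbitrary: C v rule: less_induct)
  case less
  obtain W where W: "W \<subseteq> C" "v \<in> W" "connected_on E W" "non_neighbors E C W \<noteq> {}"
    and complete: "\<forall>u \<in> C - W. \<forall>w \<in> W. \<forall>f \<in> non_neighbors E C W.
      (w, u) \<in> E \<longrightarrow> (u, f) \<in> E"
    using maximal_connected_on[OF less.prems] .
  define F where "F = non_neighbors E C W"
  have F: "F \<subseteq> C" "F \<subseteq> non_neighbors E C {v}" "v \<notin> F"
    using W by (auto simp: F_def non_neighbors_def)
  have "\<exists>a \<in> F. avoidable_on E F a"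
  \<comment> \<open>The vertex \<open>b\<close> need not be related to \<open>v\<close>: it only has
    to be non-universal in \<open>F\<close>, so that the induction hypothesis applies to the smaller
    set \<open>F\<close>.\<close>
  proof (cases "\<exists>b \<in> F. non_neighbors E F {b} \<noteq> {}")
    case True
    then obtain b where b: "b \<in> F" "non_neighbors E F {b} \<noteq> {}"
      by blast
    have "card F < card C"
      using F \<open>v \<in> C\<close> \<open>finite C\<close> by (intro psubset_card_mono) auto
    moreover have "finite F"
      using F(1) \<open>finite C\<close> by (rule finite_subset)
    ultimately have "\<exists>a \<in> non_neighbors E F {b}. avoidable_on E F a"
      using less.hyps \<open>sym E\<close> b by simp
    then show ?thesis
      by (auto simp: non_neighbors_def)
  next
    case False
    \<comment> \<open>Now \<open>F\<close> is a clique, so a single edge or the trivial walk joins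
      any two of its vertices.\<close>
    then have "x = y \<or> (x, y) \<in> E" if "x \<in> F" "y \<in> F" for x y
      using that by (auto simp: non_neighbors_def)
    then have "(x, y) \<in> rtrancl_on ({x, y} \<union> A) E" if "x \<in> F" "y \<in> F" for x y A
      using that rtrancl_on_edge[of x y E "{x, y} \<union> A"] by auto
    then have "avoidable_on E F a" for a
      by (simp add: avoidable_on_def)
    then show ?thesis
      using W(4) by (auto simp: F_def)
  qed
  then obtain a where a: "a \<in> F" "avoidable_on E F a"
    by blast
  have "avoidable_on E C a"
    unfolding avoidable_on_def
  proof (intro ballI impI)
    fix x y
    assume xy: "x \<in> C" "y \<in> C" and E: "(a, x) \<in> E" "(a, y) \<in> E"
    let ?A = "{x, y} \<union> non_neighbors E C {a}"
    \<comment> \<open>As \<open>a\<close> has no neighbour in \<open>W\<close>, its neighbour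
      \<open>z\<close> is not in \<open>W\<close>; being outside \<open>F\<close> too,
      \<open>z\<close> must see \<open>W\<close>.\<close>
    have nbr: "z \<in> C - W \<and> (\<exists>w \<in> W. (w, z) \<in> E)" if "z \<in> C" "(a, z) \<in> E" "z \<notin> F" for z
      using that a(1) \<open>sym E\<close> by (auto simp: F_def non_neighbors_def dest: symD)
    have adj: "(z, f) \<in> E" if "z \<in> C" "(a, z) \<in> E" "z \<notin> F" "f \<in> F" for z f
      using nbr[OF that(1-3)] complete that(4) by (auto simp: F_def)
    consider "x \<in> F" "y \<in> F" | "x \<in> F" "y \<notin> F" | "x \<notin> F" "y \<in> F" | "x \<notin> F" "y \<notin> F"
      by blast
    then show "(x, y) \<in> rtrancl_on ?A E"
    proof cases
      case 1
      then have "(x, y) \<in> rtrancl_on ({x, y} \<union> non_neighbors E F {a}) E"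
        using a(2) E by (simp add: avoidable_on_def)
      then show ?thesis
        by (rule rtrancl_on_mono[rotated 2]) (use F(1) in \<open>auto simp: non_neighbors_def\<close>)
    next
      case 2
      then have "(x, y) \<in> E"
        using adj xy E \<open>sym E\<close> by (meson symD)
      then show ?thesis
        by (rule rtrancl_on_edge) auto
    next
      case 3
      then have "(x, y) \<in> E"
        using adj xy E by blast
      then show ?thesis
        by (rule rtrancl_on_edge) auto
    next
      case 4
      \<comment> \<open>\<open>W\<close> contains neither \<open>a\<close> nor a neighbour of
        \<open>a\<close>, so a detour through \<open>W\<close> is allowed.\<close>
      have "W \<subseteq> ?A"
        using a(1) W(1) \<open>sym E\<close> by (auto simp: F_def non_neighbors_def dest: symD)
      moreover obtain w w' where "w \<in> W" "(w, x) \<in> E" "w' \<in> W" "(w', y) \<in> E"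
        using nbr xy E 4 by blast
      ultimately show ?thesis
        using rtrancl_on_through_connected[OF \<open>sym E\<close> W(3)] by simp
    qed
  qed
  with a F show ?case
    by blast
qed

text \<open>Reachability in the induced subgraph on \<open>S\<close> yields a path there, which is
  also a path of \<open>G\<close>. Since a path does not repeat vertices, its endpoints are not
  internal.\<close>

lemma (in wf_digraph) rtrancl_on_imp_apath:
  assumes "S \<subseteq> verts G" "(x, y) \<in> rtrancl_on S (arcs_ends G)"
  obtains p where "apath x p y" "set (inner_verts p) \<subseteq> S - {x, y}"
proof -
  interpret S: wf_digraph "G \<restriction> S"
    by (rule wellformed_induce_subgraph)
  have edge: "z \<rightarrow>\<^bsub>G \<restriction> S\<^esub> w" if "z \<rightarrow> w" "z \<in> S" "w \<in> S" for z w
    using that by (auto simp: arcs_ends_conv)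
  have "(x, y) \<in> rtrancl_on S (arcs_ends (G \<restriction> S))"
    using assms(2)
  proof (induction rule: rtrancl_on_induct)
    case (step z w)
    then show ?case
      using edge by (meson rtrancl_on_into_rtrancl_on)
  qed auto
  then have "x \<rightarrow>\<^sup>*\<^bsub>G \<restriction> S\<^esub> y"
    by (simp add: reachable_def)
  then obtain p where p: "S.apath x p y"
    by (auto simp: S.reachable_apath)
  have "subgraph (G \<restriction> S) G"
    using assms(1) by (rule subgraph_induce_subgraphI)
  then have "apath x p y"
    by (rule subgraph_apath_imp_apath[OF p])
  moreover have "set (inner_verts p) \<subseteq> S - {x, y}"
  proof -
    have "set (S.awalk_verts x p) \<subseteq> S"
      using p unfolding S.apath_def S.awalk_conv induce_subgraph_verts by (elim conjE)
    then have "set (S.inner_verts p) \<subseteq> S - {x, y}"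
      unfolding S.set_inner_verts[OF p] by (rule Diff_mono) (rule subset_refl)
    then show ?thesis
      \<comment> \<open>Internal vertices depend only on the tail map, which the induced subgraph
        inherits.\<close>
      unfolding inner_verts_def S.inner_verts_def induce_subgraph_tail .
  qed
  ultimately show ?thesis
    by (rule that)
qed

text \<open>The endpoints \<open>x\<close> and \<open>y\<close> are themselves neighbours of
  \<open>a\<close>, so the walk must be shortened to a path, whose internal vertices then all lie
  outside the closed neighbourhood of \<open>a\<close>.\<close>

lemma (in wf_digraph) avoidable_on_imp_avoidable:
  assumes "a \<in> verts G" "avoidable_on (arcs_ends G) (verts G) a"
  shows "avoidable G a"
  unfolding avoidable_def
proof (intro conjI ballI impI)
  fix x y
  assume xy: "x \<in> neighborhood G a" "y \<in> neighborhood G a"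
  let ?S = "{x, y} \<union> non_neighbors (arcs_ends G) (verts G) {a}"
  have "(x, y) \<in> rtrancl_on ?S (arcs_ends G)"
    using assms xy by (auto simp: avoidable_on_def neighborhood_def)
  moreover have "?S \<subseteq> verts G"
    using xy by (auto simp: neighborhood_def non_neighbors_def)
  ultimately obtain p where "apath x p y" "set (inner_verts p) \<subseteq> ?S - {x, y}"
    using rtrancl_on_imp_apath by blast
  moreover have "non_neighbors (arcs_ends G) (verts G) {a} \<inter> closed_neighborhood G a = {}"
    by (auto simp: non_neighbors_def closed_neighborhood_def neighborhood_def)
  ultimately show "\<exists>p. apath x p y \<and> set (inner_verts p) \<inter> closed_neighborhood G a = {}"
    by blast
qed fact

theorem theorem3p4:
  fixes G :: "('a, 'b) pre_digraph" and v :: 'a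
  assumes "graph G"
    and "verts G \<noteq> {}"
    and "v \<in> verts G"
    and "\<not> universal_vertex G v"
  shows "\<exists>a \<in> verts G - closed_neighborhood G v. avoidable G a"
proof -
  interpret graph G by fact
  have eq: "non_neighbors (arcs_ends G) (verts G) {v} = verts G - closed_neighborhood G v"
    by (auto simp: non_neighbors_def closed_neighborhood_def neighborhood_def)
  have "non_neighbors (arcs_ends G) (verts G) {v} \<noteq> {}"
    using assms(3,4) by (auto simp: universal_vertex_def non_neighbors_def)
  moreover have "sym (arcs_ends G)"
    using sym_arcs by (simp add: symmetric_def)
  ultimately obtain a where "a \<in> verts G - closed_neighborhood G v"
      "avoidable_on (arcs_ends G) (verts G) a"
    using exists_avoidable_on[of "verts G" "arcs_ends G" v] assms(3) eq by auto
  then show ?thesis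
    using avoidable_on_imp_avoidable by blast
qed

end
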